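(* $gr^3_2(B_9)=15$.
   Context: $K_n$ is the complete graph of order $n$. The book $B_n:=K_2+nK_1$ (graph join) is the graph on $n+2$ vertices consisting of an edge $xy$ (the spine) together with $n$ further, pairwise non-adjacent vertices (the pages), each adjacent to both $x$ and $y$. A $t$-coloring of $K_p$ is a map $f:E(K_p)\to\{1,\dots,t\}$, not assumed surjective. A Gallai $t$-coloring is a $t$-coloring with no rainbow triangle, i.e. there are no three vertices $x,y,z$ such that $f(xy),f(xz),f(yz)$ are pairwise distinct. For $1\le s<t$ and a graph $G$, the weakened Gallai-Ramsey number $gr^t_s(G)$ is the least $p\in\mathbb{N}$ such that every Gallai $t$-coloring of $K_p$ contains a (not necessarily induced) subgraph isomorphic to $G$ whose edges use at most $s$ colors. *)

theory Defs
  imports Main "HOL-Library.Ramsey"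
begin

text \<open>
  Finite simple graphs are given by a vertex set and a set of two-element subsets of it.
  As in \<^theory>\<open>HOL-Library.Ramsey\<close>, the set of all two-element subsets of \<^term>\<open>V\<close> is
  \<^term>\<open>nsets V 2\<close>, and an edge coloring is a function on sets of vertices, of which only
  the values on edges matter.
\<close>

datatype 'a graph = Graph (verts: "'a set") (edges: "'a set set")

definition simple_graph :: "'a graph \<Rightarrow> bool" where
  "simple_graph G \<longleftrightarrow> finite (verts G) \<and> edges G \<subseteq> nsets (verts G) 2"

definition complete_graph :: "nat \<Rightarrow> nat graph" where
  "complete_graph n = Graph {..<n} (nsets {..<n} 2)"

definition empty_graph :: "nat \<Rightarrow> nat graph" where
  "empty_graph n = Graph {..<n} {}"

definition graph_join :: "'a graph \<Rightarrow> 'b graph \<Rightarrow> ('a + 'b) graph" where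
  "graph_join G H = Graph (verts G <+> verts H)
     ((\<lambda>e. Inl ` e) ` edges G \<union> (\<lambda>e. Inr ` e) ` edges H \<union>
      {{Inl u, Inr v} | u v. u \<in> verts G \<and> v \<in> verts H})"

definition book :: "nat \<Rightarrow> (nat + nat) graph" where
  "book n = graph_join (complete_graph 2) (empty_graph n)"

definition subgraph :: "'a graph \<Rightarrow> 'a graph \<Rightarrow> bool" where
  "subgraph H G \<longleftrightarrow> simple_graph H \<and> verts H \<subseteq> verts G \<and> edges H \<subseteq> edges G"

definition graph_isomorphic :: "'a graph \<Rightarrow> 'b graph \<Rightarrow> bool" where
  "graph_isomorphic G H \<longleftrightarrow>
     (\<exists>\<phi>. bij_betw \<phi> (verts G) (verts H) \<and> edges H = (\<lambda>e. \<phi> ` e) ` edges G)"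

definition edge_coloring :: "nat \<Rightarrow> nat \<Rightarrow> (nat set \<Rightarrow> nat) \<Rightarrow> bool" where
  "edge_coloring t p f \<longleftrightarrow> f \<in> edges (complete_graph p) \<rightarrow> {1..t}"

definition rainbow_triangle :: "(nat set \<Rightarrow> nat) \<Rightarrow> nat \<Rightarrow> nat \<Rightarrow> nat \<Rightarrow> bool" where
  "rainbow_triangle f x y z \<longleftrightarrow> distinct [x, y, z] \<and> distinct [f {x, y}, f {x, z}, f {y, z}]"

definition gallai_coloring :: "nat \<Rightarrow> nat \<Rightarrow> (nat set \<Rightarrow> nat) \<Rightarrow> bool" where
  "gallai_coloring t p f \<longleftrightarrow> edge_coloring t p f \<and>
     \<not> (\<exists>x\<in>verts (complete_graph p). \<exists>y\<in>verts (complete_graph p).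
          \<exists>z\<in>verts (complete_graph p). rainbow_triangle f x y z)"

definition contains_with_colors ::
    "'a graph \<Rightarrow> nat \<Rightarrow> nat \<Rightarrow> (nat set \<Rightarrow> nat) \<Rightarrow> bool" where
  "contains_with_colors G s p f \<longleftrightarrow>
     (\<exists>H. subgraph H (complete_graph p) \<and> graph_isomorphic G H \<and> card (f ` edges H) \<le> s)"

text \<open>
  The notion is meant for \<open>1 \<le> s < t\<close>.  If no \<open>p\<close> had the stated property, the value of
  \<open>LEAST\<close> would be unspecified.
\<close>

definition weakened_gallai_ramsey :: "nat \<Rightarrow> nat \<Rightarrow> 'a graph \<Rightarrow> nat" where
  "weakened_gallai_ramsey t s G =
     (LEAST p. \<forall>f. gallai_coloring t p f \<longrightarrow> contains_with_colors G s p f)"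

end

theory Submission
  imports Defs
begin

text \<open>
  For an edge \<open>xy\<close> of a 3-coloring of \<open>K\<^sub>1\<^sub>5\<close> and a color \<open>k\<close> other than that of \<open>xy\<close>, a
  book \<open>B\<^sub>9\<close> on the spine \<open>xy\<close> avoiding \<open>k\<close> is absent iff the \<open>k\<close>-neighborhoods of \<open>x\<close> and \<open>y\<close>
  have at least 5 vertices in their union.  In a Gallai 3-coloring some color \<open>k\<close> is disconnected,
  and the edges between two components of \<open>k\<close> have a single color.  Since the two ends of such an
  edge have at least 5 incident \<open>k\<close>-edges together, two components have at least 7 vertices
  together, so there are at most four of them.  Either some bipartition of the vertices has all
  crossing edges of one color, or there are exactly four components and the other two colors form
  complementary paths on them; the latter is excluded by adding up four inequalities.  In the former
  case the smaller side has 1 or 7 vertices: 7 contradicts \<open>R(3,3) = 6\<close>, and if it is a single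
  vertex, the same dichotomy applied to the other 14 vertices gives a contradiction.
\<close>

section \<open>Gallai 3-colorings: neighborhoods, components and bipartitions by color\<close>

locale gallai3 =
  fixes V :: "'a set" and c :: "'a \<Rightarrow> 'a \<Rightarrow> 'c" and K :: "'c set"
  assumes finV: "finite V"
    and card_K: "card K = 3"
    and sym: "c x y = c y x"
    and in_K: "\<lbrakk>x \<in> V; y \<in> V; x \<noteq> y\<rbrakk> \<Longrightarrow> c x y \<in> K"
    and no_rainbow: "\<lbrakk>x \<in> V; y \<in> V; z \<in> V; x \<noteq> y; x \<noteq> z; y \<noteq> z\<rbrakk>
      \<Longrightarrow> c x y = c x z \<or> c x y = c y z \<or> c x z = c y z"
begin

definition nb :: "'c \<Rightarrow> 'a \<Rightarrow> 'a set" where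
  "nb k x = {y \<in> V. y \<noteq> x \<and> c x y = k}"

definition adj :: "'c \<Rightarrow> 'a \<Rightarrow> 'a \<Rightarrow> bool" where
  "adj k x y \<longleftrightarrow> x \<in> V \<and> y \<in> V \<and> x \<noteq> y \<and> c x y = k"

definition comp :: "'c \<Rightarrow> 'a \<Rightarrow> 'a set" where
  "comp k x = {y. (adj k)\<^sup>*\<^sup>* x y}"

text \<open>Such a set is a nonempty proper union of \<open>k\<close>-components, so its existence
  says that color \<open>k\<close> does not connect \<open>V\<close>.\<close>

definition cut :: "'c \<Rightarrow> 'a set \<Rightarrow> bool" where
  "cut k A \<longleftrightarrow> A \<subseteq> V \<and> A \<noteq> {} \<and> A \<noteq> V \<and> (\<forall>x\<in>A. \<forall>y\<in>V - A. c x y \<noteq> k)"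

text \<open>Stronger than a module, where each outside vertex may have its own color: one color on
  all crossing edges makes the notion symmetric under complement.\<close>

definition hom :: "'c \<Rightarrow> 'a set \<Rightarrow> bool" where
  "hom i A \<longleftrightarrow> A \<subseteq> V \<and> A \<noteq> {} \<and> A \<noteq> V \<and> (\<forall>x\<in>A. \<forall>y\<in>V - A. c x y = i)"

text \<open>Allows the deletion of a vertex, in the induction for \<open>cut_exists\<close> and in
  \<open>no_coloring_15\<close>.\<close>

lemma gallai3_subset: "A \<subseteq> V \<Longrightarrow> gallai3 A c K"
proof
  assume A: "A \<subseteq> V"
  show "finite A" using A finV finite_subset by blast
  show "card K = 3" "\<And>x y. c x y = c y x" by (fact card_K sym)+
  show "c x y \<in> K" if "x \<in> A" "y \<in> A" "x \<noteq> y" for x y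
    using that A in_K by blast
  show "c x y = c x z \<or> c x y = c y z \<or> c x z = c y z"
    if "x \<in> A" "y \<in> A" "z \<in> A" "x \<noteq> y" "x \<noteq> z" "y \<noteq> z" for x y z
    using that A no_rainbow by blast
qed

lemma hom_Compl: "hom i A \<Longrightarrow> hom i (V - A)"
  unfolding hom_def by (metis Diff_Diff_Int Diff_eq_empty_iff Diff_subset Int_absorb1 Int_iff
      subset_antisym sym)

lemma third_color:
  assumes "i \<in> K" "j \<in> K" "i \<noteq> j"
  obtains k where "K = {i, j, k}" "k \<noteq> i" "k \<noteq> j"
proof -
  have "finite K" using card_K card.infinite by fastforce
  then have "card (K - {i, j}) = 1" using assms card_K by (subst card_Diff_subset) auto
  then obtain k where "K - {i, j} = {k}" by (auto simp: card_1_singleton_iff)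
  then show thesis using that[of k] assms by auto
qed

lemma other_colors:
  assumes "i \<in> K"
  obtains j k where "K = {i, j, k}" "j \<noteq> i" "k \<noteq> i" "k \<noteq> j"
proof -
  have "\<not> K \<subseteq> {i}"
  proof
    assume "K \<subseteq> {i}"
    then have "card K \<le> card {i}" by (intro card_mono) auto
    then show False using card_K by simp
  qed
  then obtain j where "j \<in> K" "j \<noteq> i" by auto
  then show thesis using third_color[OF assms, of j] that by metis
qed

lemma fin_nb [simp]: "finite (nb k x)"
  using finV by (simp add: nb_def)

lemma sum_degrees:
  assumes "x \<in> V" "K = {i, j, k}" "j \<noteq> i" "k \<noteq> i" "k \<noteq> j"
  shows "card (nb i x) + card (nb j x) + card (nb k x) = card V - 1"
proof -
  have "V - {x} = nb i x \<union> nb j x \<union> nb k x"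
    using assms(1,2) in_K[of x] by (auto simp: nb_def)
  moreover have "card (nb i x \<union> nb j x \<union> nb k x) = card (nb i x) + card (nb j x) + card (nb k x)"
    using assms(3-5) by (subst card_Un_disjoint; (subst card_Un_disjoint)?) (auto simp: finV nb_def)
  ultimately show ?thesis using assms(1) by (metis card_Diff_singleton)
qed

lemma comp_refl [simp]: "x \<in> comp k x"
  by (simp add: comp_def)

lemma comp_subset: "x \<in> V \<Longrightarrow> comp k x \<subseteq> V"
proof
  fix y assume "x \<in> V" "y \<in> comp k x"
  then have "(adj k)\<^sup>*\<^sup>* x y" by (simp add: comp_def)
  then show "y \<in> V" using \<open>x \<in> V\<close> by induction (auto simp: adj_def)
qed

lemma comp_eq: "y \<in> comp k x \<Longrightarrow> comp k y = comp k x"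
proof -
  assume "y \<in> comp k x"
  then have "(adj k)\<^sup>*\<^sup>* x y" by (simp add: comp_def)
  moreover have "symp ((adj k)\<^sup>*\<^sup>*)"
    by (rule symp_rtranclp) (auto intro!: sympI simp: adj_def sym)
  ultimately have "(adj k)\<^sup>*\<^sup>* y x" by (blast dest: sympD)
  then show ?thesis using \<open>(adj k)\<^sup>*\<^sup>* x y\<close> by (auto simp: comp_def)
qed

lemma comp_disjoint: "y \<notin> comp k x \<Longrightarrow> comp k x \<inter> comp k y = {}"
  using comp_eq comp_refl by (metis disjoint_iff)

lemma fin_comp: "x \<in> V \<Longrightarrow> finite (comp k x)"
  using comp_subset finV finite_subset by metis

lemma comp_adj: "y \<in> comp k x \<Longrightarrow> adj k y z \<Longrightarrow> z \<in> comp k x"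
  by (auto simp: comp_def)

lemma nb_subset_comp: "x \<in> V \<Longrightarrow> nb k x \<subseteq> comp k x - {x}"
  by (auto simp: nb_def intro: comp_adj[OF comp_refl] simp: adj_def)

lemma card_nb_less_comp:
  assumes "x \<in> V"
  shows "card (nb k x) < card (comp k x)"
proof (rule psubset_card_mono)
  show "finite (comp k x)" by (rule fin_comp[OF assms])
  show "nb k x \<subset> comp k x" using nb_subset_comp[OF assms, of k] comp_refl[of x k] by blast
qed

lemma color_outside: "x \<in> V \<Longrightarrow> y \<in> comp k x \<Longrightarrow> z \<in> V \<Longrightarrow> z \<notin> comp k x \<Longrightarrow> c y z \<noteq> k"
  using comp_adj[of y k x z] comp_subset[of x k] by (auto simp: adj_def)

text \<open>For a \<open>k\<close>-edge inside the component, the triangle with \<open>z\<close> has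
  two further edges, neither of color \<open>k\<close>. It is not rainbow, so these two agree; this
  carries over along a \<open>k\<close>-path.\<close>

lemma color_const1:
  assumes "x \<in> V" "y \<in> comp k x" "z \<in> V" "z \<notin> comp k x"
  shows "c y z = c x z"
proof -
  have "(adj k)\<^sup>*\<^sup>* x y" using assms by (simp add: comp_def)
  then show ?thesis
  proof induction
    case (step y y')
    have y: "y \<in> comp k x" and y': "y' \<in> comp k x"
      using step by (auto simp: comp_def)
    have "c y z \<noteq> k" "c y' z \<noteq> k"
      using color_outside assms y y' by auto
    moreover have "y \<noteq> z" "y' \<noteq> z" using y y' assms by auto
    ultimately have "c y z = c y' z"
      using no_rainbow[of y y' z] step(2) assms by (auto simp: adj_def)
    then show ?case using step by simp
  qed simp
qed

text \<open>Moves one end of the edge at a time. Components can thus be treated as the vertices of a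
  smaller colored complete graph.\<close>

lemma color_const:
  assumes "x \<in> V" "y \<in> V" "y \<notin> comp k x" "u \<in> comp k x" "w \<in> comp k y"
  shows "c u w = c x y"
proof -
  have "w \<notin> comp k x" "w \<in> V" "x \<notin> comp k y"
    using assms comp_disjoint[of y k x] comp_subset[of y k] comp_refl[of x k] by blast+
  then show ?thesis
    using color_const1[of x u k w] color_const1[of y w k x] assms by (metis sym)
qed

section \<open>Existence of a disconnected color\<close>

lemma cut_comp:
  assumes "cut k A" "x \<in> V"
  shows "comp k x \<noteq> V"
proof -
  have *: "comp k x \<subseteq> B" if "cut k B" "x \<in> B" for B
  proof
    fix y assume "y \<in> comp k x"
    then have "(adj k)\<^sup>*\<^sup>* x y" by (simp add: comp_def)
    then show "y \<in> B"
      using that by induction (auto simp: cut_def adj_def)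
  qed
  have "c x y \<noteq> k" if "x \<in> V - A" "y \<in> V - (V - A)" for x y
    using assms(1) that sym[of x y] unfolding cut_def by auto
  then have "cut k (V - A)" using assms(1) unfolding cut_def by blast
  then show ?thesis
    using *[of A] *[of "V - A"] assms unfolding cut_def by blast
qed

end

text \<open>Vertices are added one at a time. If the new vertex \<open>v\<close> joins all
  \<open>k\<close>-components together, then another color becomes disconnected.\<close>

lemma (in gallai3) cut_exists:
  assumes "card V \<ge> 2"
  shows "\<exists>k\<in>K. \<exists>A. cut k A"
  using finV assms gallai3_axioms
proof (induction V rule: finite_induct)
  case empty
  then show ?case by simp
next
  case (insert v V)
  interpret W: gallai3 "insert v V" c K by fact
  interpret V: gallai3 V c K by (rule W.gallai3_subset) auto
  show ?case
  proof (cases "card V \<ge> 2")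
    case False
    then have "card V = 1" using insert by simp
    then obtain u where u: "V = {u}" by (auto simp: card_1_singleton_iff)
    then have "c v u \<in> K" using insert.hyps by (intro W.in_K) auto
    then obtain j k where "K = {c v u, j, k}" "j \<noteq> c v u" using W.other_colors by metis
    moreover have "c v u \<noteq> j" using calculation by auto
    ultimately have "j \<in> K" "W.cut j {v}" using u insert.hyps unfolding W.cut_def by auto
    then show ?thesis by blast
  next
    case True
    then obtain k A where k: "k \<in> K" and A: "V.cut k A"
      using insert.IH V.gallai3_axioms by blast
    show ?thesis
    proof (cases "\<exists>x\<in>V. \<forall>y\<in>V.comp k x. c v y \<noteq> k")
      case True
      then obtain x where x: "x \<in> V" "\<forall>y\<in>V.comp k x. c v y \<noteq> k" by blast
      have "W.cut k (V.comp k x)"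
        unfolding W.cut_def
      proof (intro conjI ballI)
        fix w z assume "w \<in> V.comp k x" "z \<in> insert v V - V.comp k x"
        then show "c w z \<noteq> k"
          using x V.color_outside[of x w k z] W.sym[of v w] by auto
      qed (use x V.comp_subset[of x k] insert.hyps V.comp_refl[of x k] in blast)+
      then show ?thesis using k by blast
    next
      case False
      then have touch: "\<exists>y\<in>V.comp k x. c v y = k" if "x \<in> V" for x
        using that by blast
      show ?thesis
      proof (cases "\<forall>y\<in>V. c v y = k")
        case True
        obtain j l where "K = {k, j, l}" "j \<noteq> k" using W.other_colors k by metis
        then have "j \<in> K" "W.cut j {v}" using True insert.hyps A
          by (auto simp: W.cut_def V.cut_def)
        then show ?thesis by blast
      next
        case False
        then obtain y where y: "y \<in> V" "c v y \<noteq> k" by blast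
        \<comment> \<open>The component of \<open>z\<close> has a vertex \<open>x'\<close> with
          \<open>v x'\<close> of color \<open>k\<close>. The other two edges of the triangle
          \<open>v w x'\<close> avoid \<open>k\<close>, so they agree, and \<open>w\<close> is
          joined to \<open>x'\<close> and \<open>z\<close> in the same color.\<close>
        have far: "c w z = c v w" if w: "w \<in> V.comp k y" "c v w \<noteq> k" and z: "z \<in> V" "z \<notin> V.comp k y" for w z
        proof -
          have wV: "w \<in> V" using w V.comp_subset y by blast
          obtain x' where x': "x' \<in> V.comp k z" "c v x' = k" using touch z by blast
          have x'V: "x' \<in> V" using x' V.comp_subset z by blast
          have out: "x' \<notin> V.comp k y"
            using x'(1) V.comp_eq z V.comp_refl by metis
          then have "c w x' \<noteq> k" using V.color_outside y w x'V by blast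
          moreover have "w \<noteq> x'" "v \<noteq> w" "v \<noteq> x'" using out w wV x'V insert.hyps by blast+
          ultimately have "c w x' = c v w"
            using W.no_rainbow[of v w x'] wV x'V insert.hyps x'(2) w(2) by auto
          moreover have "c w x' = c w z"
            using V.color_const[of y z k w x'] V.color_const[of y z k w z] y z w x' by auto
          ultimately show ?thesis by simp
        qed
        have "c v y \<in> K" using y insert.hyps by (intro W.in_K) auto
        then obtain i where i: "K = {k, c v y, i}" "i \<noteq> k" "i \<noteq> c v y"
          using W.third_color[of k "c v y"] k y by metis
        obtain z where z: "z \<in> V" "z \<notin> V.comp k y"
          using V.cut_comp[OF A, of y] V.comp_subset[of y k] y by blast
        have col: "c w z' = c v y" if "w \<in> V.comp k y" "z' \<in> V" "z' \<notin> V.comp k y" for w z'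
          using far[of y z'] V.color_const1[of y w k z'] y that V.comp_refl by simp
        have vi: "c v w \<noteq> i" if "w \<in> V.comp k y" for w
          using far[of w z] col[of w z] z that i by auto
        \<comment> \<open>Edges from the component of \<open>y\<close> to the rest of
          \<open>V\<close> have color \<open>c v y\<close>, and those to \<open>v\<close> have color
          \<open>k\<close> or \<open>c v y\<close>, so the third color \<open>i\<close> never leaves
          it.\<close>
        have "W.cut i (V.comp k y)"
          unfolding W.cut_def
        proof (intro conjI ballI)
          fix w z' assume *: "w \<in> V.comp k y" "z' \<in> insert v V - V.comp k y"
          then show "c w z' \<noteq> i"
            using col[of w z'] W.sym[of v w] vi[of w] i by auto
        qed (use y V.comp_subset[of y k] insert.hyps V.comp_refl[of y k] in blast)+
        then show ?thesis using i by auto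
      qed
    qed
  qed
qed

section \<open>The components when no bipartition is one-colored\<close>

context gallai3
begin

text \<open>\<open>S\<close> stands for the components joined to that of \<open>x\<close> in colors
  other than \<open>i\<close>. Within its own component, an \<open>i\<close>-neighbor of
  \<open>u\<close> is not a \<open>k\<close>-neighbor.\<close>

lemma single_color_nb:
  assumes x: "x \<in> V" and y: "y \<in> V" "y \<notin> comp k x"
    and cov: "V \<subseteq> comp k x \<union> comp k y \<union> S"
    and S: "\<And>s. s \<in> S \<Longrightarrow> c x s \<noteq> i \<and> s \<in> V \<and> s \<notin> comp k x"
    and i: "i \<noteq> k" and u: "u \<in> comp k x"
  shows "nb i u \<subseteq> comp k y \<union> (comp k x - {u} - nb k u)"
proof
  fix w assume w: "w \<in> nb i u"
  then have "w \<notin> S" using S[of w] color_const1[OF x u, of w] by (auto simp: nb_def)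
  then show "w \<in> comp k y \<union> (comp k x - {u} - nb k u)"
    using w cov i by (auto simp: nb_def)
qed

lemma card_nb_bound:
  assumes x: "x \<in> V" and y: "y \<in> V" and u: "u \<in> comp k x"
    and sub: "nb i u \<subseteq> comp k y \<union> (comp k x - {u} - nb k u)"
  shows "card (nb i u) + card (nb k u) + 1 \<le> card (comp k y) + card (comp k x)"
proof -
  have uV: "u \<in> V" using u comp_subset x by blast
  have s: "nb k u \<subseteq> comp k x - {u}" using nb_subset_comp[OF uV, of k] comp_eq[OF u] by simp
  have "card (nb i u) \<le> card (comp k y \<union> (comp k x - {u} - nb k u))"
    using sub fin_comp x y by (intro card_mono) auto
  also have "\<dots> \<le> card (comp k y) + card (comp k x - {u} - nb k u)"
    by (rule card_Un_le)
  also have "card (comp k x - {u} - nb k u) = card (comp k x - {u}) - card (nb k u)"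
    using s by (intro card_Diff_subset) auto
  finally have "card (nb i u) \<le> card (comp k y) + (card (comp k x - {u}) - card (nb k u))" .
  moreover have "card (nb k u) \<le> card (comp k x - {u})"
    using s fin_comp x by (intro card_mono) auto
  moreover have "card (comp k x) = card (comp k x - {u}) + 1"
    using u fin_comp[OF x] by (metis Suc_eq_plus1 card.remove)
  ultimately show ?thesis by linarith
qed

text \<open>Some color other than \<open>k\<close> leaves the component of \<open>x\<close> only
  towards that of \<open>y\<close>. The removal of \<open>u\<close> and its
  \<open>k\<close>-neighbors is kept in the inclusion for the counting.\<close>

definition next_to :: "'c \<Rightarrow> 'a \<Rightarrow> 'a \<Rightarrow> bool" where
  "next_to k x y \<longleftrightarrow> (\<exists>i\<in>K. i \<noteq> k \<and>
     (\<forall>u\<in>comp k x. nb i u \<subseteq> comp k y \<union> (comp k x - {u} - nb k u)))"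

lemma hom_comp:
  assumes "a \<in> V" "comp k a \<noteq> V" "\<And>z. z \<in> V \<Longrightarrow> z \<notin> comp k a \<Longrightarrow> c a z = i"
  shows "hom i (comp k a)"
  unfolding hom_def
proof (intro conjI ballI)
  fix x y assume "x \<in> comp k a" "y \<in> V - comp k a"
  then show "c x y = i" using color_const1[OF assms(1), of x k y] assms(3)[of y] by simp
qed (use assms comp_subset[of a k] comp_refl[of a k] in blast)+

text \<open>Contract each component to a vertex; two colors remain. Two or three vertices always
  give a one-colored bipartition, and five are too many for \<open>card V\<close>. On four vertices,
  with no one-colored star at a vertex and no one-colored 4-cycle, both colors are paths. Each
  vertex is an end of exactly one of them, and passing from it to its neighbor on that path gives
  the cyclic order. The summand 2 in the hypothesis on pairs counts the two vertices themselves, so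
  \<open>s\<close> bounds the size of two components together.\<close>

lemma four_components:
  assumes nohom: "\<And>i A. \<not> hom i A" and cut: "cut k A" and k: "k \<in> K"
    and pair: "\<And>x y. \<lbrakk>x \<in> V; y \<in> V; x \<noteq> y; c x y \<noteq> k\<rbrakk> \<Longrightarrow> s \<le> card (nb k x) + card (nb k y) + 2"
    and s: "2 * card V < 5 * s"
  obtains x1 x2 x3 x4 where "{x1, x2, x3, x4} \<subseteq> V"
    "x2 \<notin> comp k x1" "x3 \<notin> comp k x1" "x4 \<notin> comp k x1"
    "x3 \<notin> comp k x2" "x4 \<notin> comp k x2" "x4 \<notin> comp k x3"
    "card V = card (comp k x1) + card (comp k x2) + card (comp k x3) + card (comp k x4)"
    "next_to k x1 x2" "next_to k x2 x3" "next_to k x3 x4" "next_to k x4 x1"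
proof -
  note result = that
  let ?C = "comp k"
  obtain i j where ij: "K = {k, i, j}" "i \<noteq> k" "j \<noteq> k" "j \<noteq> i" using other_colors k by metis
  have ne: "?C x \<noteq> V" if "x \<in> V" for x using cut_comp cut that by blast
  have symm: "y \<notin> ?C x \<Longrightarrow> x \<notin> ?C y" for x y
    using comp_eq[of x k y] comp_refl[of y k] by auto
  have col: "c x y = i \<or> c x y = j" if "x \<in> V" "y \<in> V" "y \<notin> ?C x" for x y
  proof -
    have "x \<noteq> y" using that by auto
    then show ?thesis using in_K[of x y] color_outside[of x x k y] that ij by auto
  qed
  have lt: "card (nb k z) + 1 \<le> card (?C z)" if "z \<in> V" for z
    using card_nb_less_comp[OF that, of k] by simp
  have size2: "s \<le> card (?C x) + card (?C y)" if "x \<in> V" "y \<in> V" "y \<notin> ?C x" for x y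
  proof -
    have "x \<noteq> y" using that by auto
    then show ?thesis
      using pair[of x y] color_outside[of x x k y] that lt[of x] lt[of y] by auto
  qed
  have "V \<noteq> {}" using cut by (auto simp: cut_def)
  then obtain a where a: "a \<in> V" by blast
  obtain b where b: "b \<in> V" "b \<notin> ?C a" using ne[OF a] comp_subset[OF a] by blast
  have "\<not> V \<subseteq> ?C a \<union> ?C b"
  proof
    assume "V \<subseteq> ?C a \<union> ?C b"
    then have "c a z = c a b" if "z \<in> V" "z \<notin> ?C a" for z
      using that color_const[OF a b comp_refl] by blast
    then have "hom (c a b) (?C a)"
      using a ne by (intro hom_comp) auto
    then show False using nohom by blast
  qed
  then obtain d where d: "d \<in> V" "d \<notin> ?C a" "d \<notin> ?C b" by blast
  have three: False if V: "V \<subseteq> ?C x \<union> ?C y \<union> ?C z" and eq: "c x y = c x z"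
    and V': "x \<in> V" "y \<in> V" "z \<in> V" and "y \<notin> ?C x" "z \<notin> ?C x" for x y z
  proof -
    have "c x t = c x y" if "t \<in> V" "t \<notin> ?C x" for t
      using that V eq V' \<open>y \<notin> ?C x\<close> \<open>z \<notin> ?C x\<close>
        color_const[of x y k x t] color_const[of x z k x t] comp_refl[of x k] by auto
    then have "hom (c x y) (?C x)"
      using V' ne by (intro hom_comp) auto
    then show False using nohom by blast
  qed
  have "\<not> V \<subseteq> ?C a \<union> ?C b \<union> ?C d"
  proof
    assume V: "V \<subseteq> ?C a \<union> ?C b \<union> ?C d"
    \<comment> \<open>In a triangle with two colors, some vertex has both its edges of the same
      color.\<close>
    have "c a b = c a d \<or> c b a = c b d \<or> c d a = c d b"
      using col[of a b] col[of a d] col[of b d] a b d sym by metis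
    then show False
      using three[of a b d] three[of b a d] three[of d a b] a b d symm V by blast
  qed
  then obtain e where e: "e \<in> V" "e \<notin> ?C a" "e \<notin> ?C b" "e \<notin> ?C d" by blast
  have inV: "a \<in> V" "b \<in> V" "d \<in> V" "e \<in> V" using a b d e by auto
  have sub: "?C a \<subseteq> V" "?C b \<subseteq> V" "?C d \<subseteq> V" "?C e \<subseteq> V" using inV comp_subset by auto
  have fin: "finite (?C a)" "finite (?C b)" "finite (?C d)" "finite (?C e)" using inV fin_comp by auto
  have disj: "?C a \<inter> ?C b = {}" "?C a \<inter> ?C d = {}" "?C a \<inter> ?C e = {}" "?C b \<inter> ?C d = {}"
    "?C b \<inter> ?C e = {}" "?C d \<inter> ?C e = {}"
    using b d e comp_disjoint by auto
  have card4: "card (?C a \<union> ?C b \<union> ?C d \<union> ?C e) = card (?C a) + card (?C b) + card (?C d) + card (?C e)"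
    using fin disj by (simp add: card_Un_disjoint Int_Un_distrib2)
  have cover: "V \<subseteq> ?C a \<union> ?C b \<union> ?C d \<union> ?C e"
  proof (rule ccontr)
    assume "\<not> ?thesis"
    then obtain g where g: "g \<in> V" "g \<notin> ?C a" "g \<notin> ?C b" "g \<notin> ?C d" "g \<notin> ?C e" by blast
    have "card (?C a \<union> ?C b \<union> ?C d \<union> ?C e \<union> ?C g) = card (?C a \<union> ?C b \<union> ?C d \<union> ?C e) + card (?C g)"
      using fin fin_comp[OF g(1)] g comp_disjoint[of g k a] comp_disjoint[of g k b]
        comp_disjoint[of g k d] comp_disjoint[of g k e] by (intro card_Un_disjoint) auto
    moreover have "card (?C a \<union> ?C b \<union> ?C d \<union> ?C e \<union> ?C g) \<le> card V"
      using sub comp_subset[OF g(1)] finV by (intro card_mono) auto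
    \<comment> \<open>Five bounds taken around a 5-cycle count every component twice, so
      \<open>5 * s\<close> would be at most \<open>2 * card V\<close>.\<close>
    ultimately show False
      using card4 s size2[OF a b] size2[OF inV(2) d(1,3)] size2[OF d(1) e(1,4)]
        size2[OF e(1) g(1,5)] size2[OF a g(1,2)] by linarith
  qed
  have cardV: "card V = card (?C a) + card (?C b) + card (?C d) + card (?C e)"
    using card4 cover sub by (metis Un_least subset_antisym)
  \<comment> \<open>Says that the four vertices represent all the components, once each. Its
    invariance under permutations allows the case analysis up to renaming.\<close>
  define R where "R = (\<lambda>u v w x. V \<subseteq> ?C u \<union> ?C v \<union> ?C w \<union> ?C x \<and> {u, v, w, x} \<subseteq> V \<and>
    v \<notin> ?C u \<and> w \<notin> ?C u \<and> x \<notin> ?C u \<and> w \<notin> ?C v \<and> x \<notin> ?C v \<and> x \<notin> ?C w \<and>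
    card V = card (?C u) + card (?C v) + card (?C w) + card (?C x))"
  have Rabde: "R a b d e" unfolding R_def using cover inV b d e cardV by auto
  have perm: "R v u w x \<and> R u w v x \<and> R u v x w" if "R u v w x" for u v w x
    using that symm unfolding R_def by auto
  have next_to: "next_to k u v" if "R u v w x" "c u v \<noteq> c u w" "c u v \<noteq> c u x" for u v w x
    unfolding next_to_def
  proof (intro bexI conjI ballI)
    show "c u v \<in> K" "c u v \<noteq> k"
      using that(1) col[of u v] ij unfolding R_def by auto
    fix z assume z: "z \<in> ?C u"
    show "nb (c u v) z \<subseteq> ?C v \<union> (?C u - {z} - nb k z)"
    proof (rule single_color_nb[where S = "?C w \<union> ?C x"])
      fix t assume t: "t \<in> ?C w \<union> ?C x"
      have "c u t = c u w \<or> c u t = c u x" 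
        using t color_const[of u w k u t] color_const[of u x k u t] that(1) unfolding R_def by auto
      moreover have "t \<in> V" using t that(1) comp_subset[of w k] comp_subset[of x k] unfolding R_def by auto
      moreover have "t \<notin> ?C u" using t that(1) comp_disjoint[of w k u] comp_disjoint[of x k u]
        unfolding R_def by auto
      ultimately show "c u t \<noteq> c u v \<and> t \<in> V \<and> t \<notin> ?C u" using that by auto
    qed (use that(1) z \<open>c u v \<noteq> k\<close> in \<open>auto simp: R_def\<close>)
  qed
  have star: False if "R u v w x" "c u v = c u w" "c u v = c u x" for u v w x
  proof -
    have "c u t = c u v" if "t \<in> V" "t \<notin> ?C u" for t
      using that \<open>R u v w x\<close> \<open>c u v = c u w\<close> \<open>c u v = c u x\<close> comp_refl[of u k]
        color_const[of u v k u t] color_const[of u w k u t] color_const[of u x k u t]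
      unfolding R_def by auto
    then have "hom (c u v) (?C u)"
      using \<open>R u v w x\<close> ne hom_comp[of u k] unfolding R_def by blast
    then show False using nohom by blast
  qed
  have split: False if R: "R u v w x" and eq: "c u w = c u x" "c u w = c v w" "c u w = c v x" for u v w x
  proof -
    have 1: "c p q = c u w" if "p \<in> ?C u \<union> ?C v" "q \<in> V - (?C u \<union> ?C v)" for p q
      using that R eq color_const[of u w k p q] color_const[of u x k p q]
        color_const[of v w k p q] color_const[of v x k p q] unfolding R_def by auto
    have "w \<in> V - (?C u \<union> ?C v)" "?C u \<union> ?C v \<subseteq> V"
      using R comp_subset unfolding R_def by auto
    then have "hom (c u w) (?C u \<union> ?C v)"
      unfolding hom_def using 1 comp_refl[of u k] by blast
    then show False using nohom by blast
  qed
  \<comment> \<open>If the colors \<open>uv = vw = wx\<close> form a path and the other color is the complementary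
    path, the sole neighbor relation runs around the cycle \<open>u, v, x, w\<close>.\<close>
  have path: thesis if R: "R u v w x" and eq: "c u v = c v w" "c v w = c w x"
    "c u w = c u x" "c v x = c u x" "c u v \<noteq> c u x" for u v w x
  proof (rule result)
    show "next_to k u v" using next_to[OF R] eq by auto
    show "next_to k v x" using next_to[of v x u w] perm R eq sym by metis
    show "next_to k x w" using next_to[of x w u v] perm R eq sym by metis
    show "next_to k w u" using next_to[of w u v x] perm R eq sym by metis
  qed (use R symm in \<open>auto simp: R_def\<close>)
  have main2: thesis
    if R: "R u v w x" and eq: "c u v \<noteq> c u w" "c u w = c u x" "c v w = c u v" "c v x = c u w" for u v w x
  proof (rule path[OF R])
    have inV': "{u, v, w, x} \<subseteq> V" "w \<notin> ?C u" "v \<notin> ?C u" "x \<notin> ?C w" using R unfolding R_def by auto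
    \<comment> \<open>Two edges at \<open>x\<close> already have the color of \<open>u w\<close>, so
      by \<open>star\<close> the third, \<open>w x\<close>, has the other color.\<close>
    have "R x u v w" using R perm by blast
    then have "c w x \<noteq> c u w" using star[of x u v w] eq sym by metis
    then show "c v w = c w x"
      using col[of u v] col[of u w] col[of w x] inV' eq by auto
  qed (use eq in auto)
  have main: thesis if R: "R u v w x" and eq: "c u v \<noteq> c u w" "c u w = c u x" for u v w x
  proof -
    have inV': "{u, v, w, x} \<subseteq> V" "w \<notin> ?C u" "v \<notin> ?C u" "w \<notin> ?C v" "x \<notin> ?C v"
      using R unfolding R_def by auto
    \<comment> \<open>\<open>v\<close> sees different colors at \<open>w\<close> and
      \<open>x\<close>: one color for both would give either a star at \<open>v\<close> or a
      one-colored bipartition into \<open>u, v\<close> and \<open>w, x\<close>.\<close>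
    have "\<not> (c v w = c u v \<and> c v x = c u v)"
      using star[of v u w x] perm R sym by metis
    moreover have "\<not> (c v w = c u w \<and> c v x = c u w)"
      using split[OF R] eq by metis
    ultimately have "c v w = c u v \<and> c v x = c u w \<or> c v x = c u v \<and> c v w = c u w"
      using col[of u v] col[of u w] col[of v w] col[of v x] inV' eq by auto
    then show thesis
    proof (elim disjE conjE)
      assume "c v w = c u v" "c v x = c u w"
      then show thesis by (rule main2[OF R eq])
    next
      assume *: "c v x = c u v" "c v w = c u w"
      have "R u v x w" using perm[OF R] by blast
      then show thesis by (rule main2) (use eq * in metis)+
    qed
  qed
  have R: "R a b d e" "R a d b e" "R a e b d" using Rabde perm by metis+
  have "\<not> (c a b = c a d \<and> c a b = c a e)" using star[OF R(1)] by blast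
  moreover have "c a b \<in> {i, j}" "c a d \<in> {i, j}" "c a e \<in> {i, j}"
    using col inV b d e by auto
  ultimately consider "c a b \<noteq> c a d" "c a d = c a e" | "c a d \<noteq> c a b" "c a b = c a e"
    | "c a e \<noteq> c a b" "c a b = c a d"
    unfolding insert_iff empty_iff by metis
  then show thesis
    by cases (use main[OF R(1)] main[OF R(2)] main[OF R(3)] in blast)+
qed

section \<open>Excluding colorings of 14 and of 15 vertices\<close>

text \<open>The situation after a vertex with all its edges in color \<open>i\<close> is deleted
  from 15 vertices: the bound 5 then falls on each single vertex in the colors \<open>l\<close> and
  \<open>m\<close>, and drops to 4 in color \<open>i\<close>, where the deleted vertex was
  counted.\<close>

lemma no_coloring_14:
  assumes K: "K = {i, l, m}" "l \<noteq> i" "m \<noteq> i" "m \<noteq> l" and n: "card V = 14"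
    and deg: "\<And>x. x \<in> V \<Longrightarrow> 5 \<le> card (nb l x)" "\<And>x. x \<in> V \<Longrightarrow> 5 \<le> card (nb m x)"
    and pair: "\<And>x y. \<lbrakk>x \<in> V; y \<in> V; x \<noteq> y; c x y \<noteq> i\<rbrakk> \<Longrightarrow> 4 \<le> card (nb i x) + card (nb i y)"
  shows False
proof -
  have total: "card (nb i x) + card (nb l x) + card (nb m x) = 13" if "x \<in> V" for x
    using sum_degrees[OF that K] n by simp
  have nohom: "\<not> hom h S" for h S
  proof
    assume "hom h S"
    then have S: "S \<subseteq> V" "S \<noteq> {}" "S \<noteq> V" and h: "\<And>x y. x \<in> S \<Longrightarrow> y \<in> V - S \<Longrightarrow> c x y = h"
      unfolding hom_def by auto
    obtain x y where x: "x \<in> S" and y: "y \<in> V - S" using S by blast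
    have xy: "x \<in> V" "y \<in> V" "x \<noteq> y" using x y S by auto
    have "V - S \<subseteq> nb h x" using h x by (auto simp: nb_def)
    then have dx: "card (V - S) \<le> card (nb h x)" by (intro card_mono) auto
    have "S \<subseteq> nb h y" using h y S(1) sym by (fastforce simp: nb_def)
    then have dy: "card S \<le> card (nb h y)" by (intro card_mono) auto
    have fS: "finite S" using S(1) finV finite_subset by blast
    have cS: "card S + card (V - S) = 14"
      using S(1) fS n by (metis card_Diff_subset card_mono finV le_add_diff_inverse)
    have h3: "h = i \<or> h = l \<or> h = m" using in_K[of x y] xy h[OF x y] K by auto
    show False
    \<comment> \<open>The \<open>h\<close>-degrees of \<open>x\<close> and \<open>y\<close> add up
      to at least 14. If \<open>h = i\<close>, each is at most 13 - 5 - 5 = 3. Otherwise the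
      remaining color other than \<open>i\<close> adds at least 10 and color \<open>i\<close> at
      least 4, which exceeds the total 26.\<close>
    proof (cases "h = i")
      case True
      then show False
        using dx dy cS total[OF xy(1)] total[OF xy(2)] deg[OF xy(1)] deg[OF xy(2)] by simp
    next
      case False
      have far: "q \<noteq> h \<Longrightarrow> nb q x \<subseteq> S - {x}" "q \<noteq> h \<Longrightarrow> nb q y \<subseteq> V - S - {y}" for q
        using h x y sym by (fastforce simp: nb_def)+
      have "4 \<le> card (nb i x) + card (nb i y)"
        using pair[OF xy] h[OF x y] False by simp
      then show False
        using dx dy cS total[OF xy(1)] total[OF xy(2)] deg[OF xy(1)] deg[OF xy(2)] False h3
        by auto
    qed
  qed
  obtain k A where k: "k \<in> K" and cut: "cut k A" using cut_exists n by auto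
  have "4 \<le> card (nb k x) + card (nb k y)" if "x \<in> V" "y \<in> V" "x \<noteq> y" "c x y \<noteq> k" for x y
    using pair[of x y] deg[of x] deg[of y] that k K by force
  then have pair': "6 \<le> card (nb k x) + card (nb k y) + 2" if "x \<in> V" "y \<in> V" "x \<noteq> y" "c x y \<noteq> k" for x y
    using that by fastforce
  obtain x1 x2 x3 x4 where x: "{x1, x2, x3, x4} \<subseteq> V"
    and out: "x2 \<notin> comp k x1" "x3 \<notin> comp k x1" "x4 \<notin> comp k x1"
    "x3 \<notin> comp k x2" "x4 \<notin> comp k x2" "x4 \<notin> comp k x3"
    and cV: "card V = card (comp k x1) + card (comp k x2) + card (comp k x3) + card (comp k x4)"
    and nx: "next_to k x1 x2" "next_to k x2 x3" "next_to k x3 x4" "next_to k x4 x1"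
  proof (rule four_components[OF nohom cut k pair'])
    show "2 * card V < 5 * 6" using n by simp
  qed
  have xV: "x1 \<in> V" "x2 \<in> V" "x3 \<in> V" "x4 \<in> V" using x by auto
  have ki: "k = i"
  proof (rule ccontr)
    assume "k \<noteq> i"
    then have "5 \<le> card (nb k z)" if "z \<in> V" for z using deg[OF that] k K by auto
    then have "6 \<le> card (comp k z)" if "z \<in> V" for z
      using card_nb_less_comp[of z k] that by fastforce
    then have "6 \<le> card (comp k x1)" "6 \<le> card (comp k x2)" "6 \<le> card (comp k x3)"
      "6 \<le> card (comp k x4)"
      using xV by blast+
    then show False using cV n by linarith
  qed
  have bound: "card (nb k u) + 6 \<le> card (comp k v) + card (comp k u)"
    if uv: "u \<in> V" "v \<in> V" "next_to k u v" for u v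
  proof -
    obtain p where p: "p \<in> K" "p \<noteq> k"
      "nb p u \<subseteq> comp k v \<union> (comp k u - {u} - nb k u)"
      using uv(3) comp_refl unfolding next_to_def by blast
    have "5 \<le> card (nb p u)" using p deg \<open>u \<in> V\<close> ki K by auto
    then show ?thesis using card_nb_bound[OF uv(1,2) comp_refl p(3)] by simp
  qed
  have p12: "4 \<le> card (nb k x1) + card (nb k x2)"
    using pair[of x1 x2] xV out color_outside[of x1 x1 k x2] comp_refl[of x1 k] ki by metis
  have p34: "4 \<le> card (nb k x3) + card (nb k x4)"
    using pair[of x3 x4] xV out color_outside[of x3 x3 k x4] comp_refl[of x3 k] ki by metis
  \<comment> \<open>The four bounds around the cycle count each component twice: the four
    \<open>k\<close>-degrees plus 24 are at most 28, but these degrees add up to at least 8.\<close>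
  show False
    using bound[OF xV(1,2) nx(1)] bound[OF xV(2,3) nx(2)] bound[OF xV(3,4) nx(3)]
      bound[OF xV(4,1) nx(4)] p12 p34 cV n by linarith
qed

text \<open>For two vertices of \<open>B\<close> and a color other than \<open>i\<close> and that of
  their edge, all neighbors in this color lie in \<open>B\<close>, so \<open>B\<close> has at least
  5 + 2 vertices. With exactly 7 the bound is tight, which makes \<open>B\<close> 2-colored without
  a monochromatic triangle.\<close>

lemma card_hom_side_15:
  assumes n: "card V = 15"
    and H: "\<And>x y k. \<lbrakk>x \<in> V; y \<in> V; x \<noteq> y; k \<in> K; c x y \<noteq> k\<rbrakk> \<Longrightarrow> 5 \<le> card (nb k x \<union> nb k y)"
    and hom: "hom i B" and small: "card B \<le> 7"
  shows "card B = 1"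
proof (rule ccontr)
  assume "card B \<noteq> 1"
  have B: "B \<subseteq> V" "B \<noteq> {}" "B \<noteq> V" and h: "\<And>x y. x \<in> B \<Longrightarrow> y \<in> V - B \<Longrightarrow> c x y = i"
    using hom unfolding hom_def by auto
  have fB: "finite B" using B(1) finV finite_subset by blast
  have "card B \<noteq> 0" using B fB by simp
  then have B2: "2 \<le> card B" using \<open>card B \<noteq> 1\<close> by linarith
  have "i \<in> K"
  proof -
    obtain x y where "x \<in> B" "y \<in> V - B" using B by blast
    then show ?thesis using in_K[of x y] h[of x y] B by auto
  qed
  then obtain l m where K: "K = {i, l, m}" "l \<noteq> i" "m \<noteq> i" "m \<noteq> l" using other_colors by metis
  have sub: "nb q x \<union> nb q y \<subseteq> B - {x, y}" if "x \<in> B" "y \<in> B" "q \<noteq> i" "q \<noteq> c x y" for x y q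
    using h that B sym by (fastforce simp: nb_def)
  have le: "5 \<le> card (B - {x, y})" if "x \<in> B" "y \<in> B" "x \<noteq> y" "q \<in> K" "q \<noteq> i" "q \<noteq> c x y" for x y q
  proof -
    have "card (nb q x \<union> nb q y) \<le> card (B - {x, y})"
      using sub[of x y q] that fB by (intro card_mono) auto
    moreover have "5 \<le> card (nb q x \<union> nb q y)" using H[of x y q] that B by auto
    ultimately show ?thesis by linarith
  qed
  have card2: "card (B - {x, y}) + 2 = card B" if "x \<in> B" "y \<in> B" "x \<noteq> y" for x y
  proof -
    have "card (B - {x, y}) = card B - 2" using that fB by (subst card_Diff_subset) auto
    then show ?thesis using B2 by simp
  qed
  have ex_q: "\<exists>q\<in>K. q \<noteq> i \<and> q \<noteq> p" for p using K by auto
  have B7: "card B = 7"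
  proof -
    obtain x y where "x \<in> B" "y \<in> B" "x \<noteq> y"
      using B2 by (metis card_2_iff' card_le_Suc0_iff_eq fB not_less_eq_eq numeral_2_eq_2)
    moreover obtain q where "q \<in> K" "q \<noteq> i" "q \<noteq> c x y" using ex_q by blast
    ultimately show ?thesis using le[of x y q] card2[of x y] small by linarith
  qed
  have all: "c x z = q \<or> c y z = q"
    if "x \<in> B" "y \<in> B" "x \<noteq> y" "q \<in> K" "q \<noteq> i" "q \<noteq> c x y" "z \<in> B" "z \<noteq> x" "z \<noteq> y" for x y z q
  proof -
    have "card (B - {x, y}) = 5" using card2[of x y] that B7 by simp
    moreover have "5 \<le> card (nb q x \<union> nb q y)" using H[of x y q] that B by auto
    ultimately have "nb q x \<union> nb q y = B - {x, y}"
      using sub[of x y q] that fB by (intro card_seteq) auto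
    then have "z \<in> nb q x \<union> nb q y" using that by simp
    then show ?thesis by (auto simp: nb_def)
  qed
  have noi: "c x y \<noteq> i" if xy: "x \<in> B" "y \<in> B" "x \<noteq> y" for x y
  proof
    assume eq: "c x y = i"
    have "card (B - {x, y}) = 5" using card2[OF xy] B7 by simp
    then have "B - {x, y} \<noteq> {}" by (metis card.empty zero_neq_numeral)
    then obtain z where z: "z \<in> B" "z \<noteq> x" "z \<noteq> y" by blast
    \<comment> \<open>Tightness for both \<open>l\<close> and \<open>m\<close> forces these two
      colors onto \<open>x z\<close> and \<open>y z\<close>, which makes the triangle
      rainbow.\<close>
    have "c x z = l \<or> c y z = l" "c x z = m \<or> c y z = m"
      using all[OF xy _ _ _ z] K eq by auto
    moreover have "c x y = c x z \<or> c x y = c y z \<or> c x z = c y z"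
      using no_rainbow[of x y z] xy z B by auto
    ultimately show False using eq K by metis
  qed
  \<comment> \<open>A color other than \<open>i\<close> and \<open>q\<close> must, by tightness,
    appear on an edge from \<open>z\<close> to \<open>x\<close> or \<open>y\<close>.\<close>
  have nomono: False if "x \<in> B" "y \<in> B" "z \<in> B" "x \<noteq> y" "x \<noteq> z" "y \<noteq> z" "c x y = q" "c x z = q" "c y z = q"
    for x y z q
    using ex_q[of q] all[of x y _ z] that by metis
  obtain v where v: "v \<in> B" using B by blast
  \<comment> \<open>The usual argument for \<open>R(3,3)\<close>: three \<open>q\<close>-neighbors
    of \<open>v\<close> would span a triangle in the one remaining color.\<close>
  have nb3: "card (nb q v) \<le> 2" if q: "q \<in> K" "q \<noteq> i" for q
  proof (rule ccontr)
    assume "\<not> ?thesis"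
    then obtain T where T: "T \<subseteq> nb q v" "card T = 3"
      by (metis obtain_subset_with_card_n not_less_eq_eq numeral_2_eq_2 numeral_3_eq_3)
    then obtain x y z where xyz: "T = {x, y, z}" "x \<noteq> y" "y \<noteq> z" "x \<noteq> z" by (auto simp: card_3_iff)
    have "nb q v \<subseteq> B" using h[OF v] q by (auto simp: nb_def)
    then have inB: "x \<in> B" "y \<in> B" "z \<in> B" and cv: "c v x = q" "c v y = q" "c v z = q" and vne: "v \<noteq> x" "v \<noteq> y" "v \<noteq> z"
      using T xyz by (auto simp: nb_def)
    obtain r where r: "\<And>s. s \<in> K \<Longrightarrow> s \<noteq> i \<Longrightarrow> s \<noteq> q \<Longrightarrow> s = r" using K q by auto
    have "c s t = r" if "s \<in> B" "t \<in> B" "s \<noteq> t" "c v s = q" "c v t = q" "v \<noteq> s" "v \<noteq> t" for s t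
      using r[of "c s t"] noi[of s t] nomono[of v s t q] in_K[of s t] that v B by auto
    then show False using nomono[of x y z r] inB cv vne xyz by metis
  qed
  have "B - {v} \<subseteq> nb l v \<union> nb m v"
    using noi[OF v] in_K[of v] v B K by (fastforce simp: nb_def)
  then have "card (B - {v}) \<le> card (nb l v \<union> nb m v)" by (intro card_mono) auto
  also have "\<dots> \<le> card (nb l v) + card (nb m v)" by (rule card_Un_le)
  also have "\<dots> \<le> 4" using nb3[of l] nb3[of m] K by auto
  finally show False using B7 v fB by simp
qed

lemma no_coloring_15:
  assumes n: "card V = 15"
    and H: "\<And>x y k. \<lbrakk>x \<in> V; y \<in> V; x \<noteq> y; k \<in> K; c x y \<noteq> k\<rbrakk> \<Longrightarrow> 5 \<le> card (nb k x \<union> nb k y)"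
  shows False
proof -
  have deg2: "5 \<le> card (nb k x) + card (nb k y)" if "x \<in> V" "y \<in> V" "x \<noteq> y" "k \<in> K" "c x y \<noteq> k" for x y k
    using H[OF that] card_Un_le[of "nb k x" "nb k y"] by linarith
  have nohom: "\<not> hom h S" for h S
  proof
    assume "hom h S"
    \<comment> \<open>One of the two sides has at most 7 of the 15 vertices.\<close>
    have "\<exists>B. hom h B \<and> card B = 1"
    proof (cases "card S \<le> 7")
      case True
      then show ?thesis using card_hom_side_15[OF n H \<open>hom h S\<close>] \<open>hom h S\<close> by blast
    next
      case False
      have "S \<subseteq> V" using \<open>hom h S\<close> by (simp add: hom_def)
      then have "card (V - S) = 15 - card S"
        using n finV by (metis card_Diff_subset finite_subset)
      then have "card (V - S) \<le> 7" using False by linarith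
      then show ?thesis using card_hom_side_15[OF n H hom_Compl] hom_Compl \<open>hom h S\<close> by blast
    qed
    then obtain y where "hom h {y}" by (auto simp: card_1_singleton_iff)
    then have y: "y \<in> V" "\<And>x. x \<in> V - {y} \<Longrightarrow> c y x = h" by (auto simp: hom_def)
    have "card (V - {y}) = 14" using y(1) n by simp
    then have "V - {y} \<noteq> {}" by force
    then obtain w where "w \<in> V - {y}" by blast
    then have "h \<in> K" using y in_K[of y w] by auto
    then obtain l m where K: "K = {h, l, m}" "l \<noteq> h" "m \<noteq> h" "m \<noteq> l" using other_colors by metis
    interpret A: gallai3 "V - {y}" c K by (rule gallai3_subset) auto
    have A_nb: "A.nb q x = nb q x - {y}" for q x by (auto simp: A.nb_def nb_def)
    have nby: "nb q y = {}" if "q \<noteq> h" for q using y that by (auto simp: nb_def)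
    have degA: "5 \<le> card (A.nb q x)" if "x \<in> V - {y}" "q \<in> K" "q \<noteq> h" for x q
    proof -
      have cxy: "c x y = h" using y(2)[OF that(1)] sym by metis
      then have "y \<notin> nb q x" using that(3) by (simp add: nb_def)
      moreover have "5 \<le> card (nb q x \<union> nb q y)" using H[of x y q] that y(1) cxy by auto
      then have "5 \<le> card (nb q x)" using nby that(3) by simp
      ultimately show ?thesis by (simp add: A_nb)
    qed
    have "4 \<le> card (A.nb h u) + card (A.nb h v)"
      if uv: "u \<in> V - {y}" "v \<in> V - {y}" "u \<noteq> v" "c u v \<noteq> h" for u v
    proof -
      have "5 \<le> card (nb h u \<union> nb h v)" using H[of u v h] uv K by auto
      moreover have "nb h u \<union> nb h v \<subseteq> insert y (A.nb h u \<union> A.nb h v)" by (auto simp: A_nb)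
      then have "card (nb h u \<union> nb h v) \<le> card (insert y (A.nb h u \<union> A.nb h v))"
        by (intro card_mono) auto
      moreover have "card (insert y (A.nb h u \<union> A.nb h v)) \<le> Suc (card (A.nb h u \<union> A.nb h v))"
        by (rule card_insert_le_m1) auto
      moreover have "card (A.nb h u \<union> A.nb h v) \<le> card (A.nb h u) + card (A.nb h v)"
        by (rule card_Un_le)
      ultimately show ?thesis by linarith
    qed
    then show False
      using A.no_coloring_14[OF K \<open>card (V - {y}) = 14\<close>] degA K by auto
  qed
  obtain k A where k: "k \<in> K" and cut: "cut k A" using cut_exists n by auto
  have pair: "7 \<le> card (nb k x) + card (nb k y) + 2" if "x \<in> V" "y \<in> V" "x \<noteq> y" "c x y \<noteq> k" for x y
    using deg2[of x y k] that k by simp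
  obtain x1 x2 x3 x4 where x: "{x1, x2, x3, x4} \<subseteq> V"
    and out: "x2 \<notin> comp k x1" "x3 \<notin> comp k x1" "x4 \<notin> comp k x1"
    "x3 \<notin> comp k x2" "x4 \<notin> comp k x2" "x4 \<notin> comp k x3"
    and cV: "card V = card (comp k x1) + card (comp k x2) + card (comp k x3) + card (comp k x4)"
    and nx: "next_to k x1 x2" "next_to k x2 x3" "next_to k x3 x4" "next_to k x4 x1"
  proof (rule four_components[OF nohom cut k pair])
    show "2 * card V < 5 * 7" using n by simp
  qed
  have xV: "x1 \<in> V" "x2 \<in> V" "x3 \<in> V" "x4 \<in> V" using x by auto
  have cross: "5 \<le> card (nb k u) + card (nb k v)"
    if "x \<in> V" "y \<in> V" "y \<notin> comp k x" "u \<in> comp k x" "v \<in> comp k y" for x y u v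
  proof -
    have uv: "u \<in> V" "v \<in> V" "v \<notin> comp k x"
      using that comp_subset comp_disjoint by blast+
    then have "u \<noteq> v" using that by auto
    then show ?thesis using deg2[of u v k] uv color_outside[of x u k v] that k by auto
  qed
  have less: "card (nb k z) + 1 \<le> card (comp k z)" if "z \<in> V" for z
    using card_nb_less_comp[OF that, of k] by simp
  note d = cross[OF xV(1,2) out(1) comp_refl comp_refl] cross[OF xV(1,3) out(2) comp_refl comp_refl]
    cross[OF xV(1,4) out(3) comp_refl comp_refl] cross[OF xV(2,3) out(4) comp_refl comp_refl]
    cross[OF xV(2,4) out(5) comp_refl comp_refl] cross[OF xV(3,4) out(6) comp_refl comp_refl]
  \<comment> \<open>If one of the four had no \<open>k\<close>-neighbor, the other three would have
    at least 5 each, giving three components of at least 6 vertices besides its own.\<close>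
  have pos: "nb k x1 \<noteq> {}" "nb k x2 \<noteq> {}" "nb k x3 \<noteq> {}" "nb k x4 \<noteq> {}"
    using d less[OF xV(1)] less[OF xV(2)] less[OF xV(3)] less[OF xV(4)] cV n by auto
  \<comment> \<open>No single degree is bounded below here, so \<open>H\<close> is applied to
    \<open>u\<close> and a \<open>k\<close>-neighbor \<open>u'\<close> of it. Their edge has color
    \<open>k\<close>, so \<open>p\<close> is a permitted color, and \<open>p\<close> leaves their
    common component only towards that of \<open>v\<close>. The 7 is 5 plus the vertices
    \<open>u\<close> and \<open>u'\<close> themselves.\<close>
  have bound: "\<exists>u'\<in>comp k u. card (nb k u) + card (nb k u') + 7 \<le> card (comp k v) + 2 * card (comp k u)"
    if u: "u \<in> V" "v \<in> V" "next_to k u v" "nb k u \<noteq> {}" for u v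
  proof -
    obtain p where p: "p \<in> K" "p \<noteq> k"
      "\<And>z. z \<in> comp k u \<Longrightarrow> nb p z \<subseteq> comp k v \<union> (comp k u - {z} - nb k z)"
      using u(3) unfolding next_to_def by blast
    obtain u' where u': "u' \<in> nb k u" using u(4) by blast
    then have mem: "u' \<in> comp k u" "u' \<in> V" "u' \<noteq> u" "c u u' = k"
      using nb_subset_comp[OF u(1), of k] by (auto simp: nb_def)
    have own: "nb k u \<subseteq> comp k u - {u}" "nb k u' \<subseteq> comp k u - {u'}"
      using nb_subset_comp[OF u(1), of k] nb_subset_comp[OF mem(2), of k] comp_eq[OF mem(1)] by auto
    have rest: "card (comp k u - {z} - nb k z) + card (nb k z) + 1 = card (comp k u)"
      if "z \<in> comp k u" "nb k z \<subseteq> comp k u - {z}" for z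
    proof -
      have "card (comp k u - {z} - nb k z) + card (nb k z) = card (comp k u - {z})"
        using that fin_comp[OF u(1), of k]
        by (metis card_Diff_subset card_mono fin_nb finite_Diff le_add_diff_inverse2)
      then show ?thesis using that(1) fin_comp[OF u(1)] by (metis Suc_eq_plus1 card.remove)
    qed
    have "5 \<le> card (nb p u \<union> nb p u')" using H[of u u' p] u(1) mem p by auto
    also have "\<dots> \<le> card (comp k v \<union> ((comp k u - {u} - nb k u) \<union> (comp k u - {u'} - nb k u')))"
      using p(3)[of u] p(3)[OF mem(1)] fin_comp u by (intro card_mono) auto
    also have "\<dots> \<le> card (comp k v) + card ((comp k u - {u} - nb k u) \<union> (comp k u - {u'} - nb k u'))"
      by (rule card_Un_le)
    also have "\<dots> \<le> card (comp k v) + (card (comp k u - {u} - nb k u) + card (comp k u - {u'} - nb k u'))"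
      using card_Un_le by (intro add_left_mono)
    finally have "card (nb k u) + card (nb k u') + 7 \<le> card (comp k v) + 2 * card (comp k u)"
      using rest[OF _ own(1)] rest[OF mem(1) own(2)] by simp
    then show ?thesis using mem(1) by blast
  qed
  obtain y1 where y1: "y1 \<in> comp k x1"
    "card (nb k x1) + card (nb k y1) + 7 \<le> card (comp k x2) + 2 * card (comp k x1)"
    using bound[OF xV(1,2) nx(1) pos(1)] by blast
  obtain y2 where y2: "y2 \<in> comp k x2"
    "card (nb k x2) + card (nb k y2) + 7 \<le> card (comp k x3) + 2 * card (comp k x2)"
    using bound[OF xV(2,3) nx(2) pos(2)] by blast
  obtain y3 where y3: "y3 \<in> comp k x3"
    "card (nb k x3) + card (nb k y3) + 7 \<le> card (comp k x4) + 2 * card (comp k x3)"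
    using bound[OF xV(3,4) nx(3) pos(3)] by blast
  obtain y4 where y4: "y4 \<in> comp k x4"
    "card (nb k x4) + card (nb k y4) + 7 \<le> card (comp k x1) + 2 * card (comp k x4)"
    using bound[OF xV(4,1) nx(4) pos(4)] by blast
  \<comment> \<open>The four bounds count each component three times, so the eight degrees plus 28
    are at most 45. Pairing vertices of different components shows that these degrees add up to at
    least 20.\<close>
  show False
    using y1(2) y2(2) y3(2) y4(2) d(1,6) cV n
      cross[OF xV(1,2) out(1) y1(1) y2(1)] cross[OF xV(3,4) out(6) y3(1) y4(1)] by linarith
qed

end

section \<open>Books with few colors, and the two bounds\<close>

lemma lessThan_2: "{..<2::nat} = {0, 1}"
  by auto

lemma verts_book: "verts (book n) = {Inl 0, Inl 1} \<union> Inr ` {..<n}"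
  by (auto simp: book_def graph_join_def complete_graph_def empty_graph_def lessThan_2)

lemma edges_book:
  "edges (book n) = insert {Inl 0, Inl 1} ((\<lambda>v. {Inl 0, Inr v}) ` {..<n} \<union> (\<lambda>v. {Inl 1, Inr v}) ` {..<n})"
proof -
  have "nsets {..<2::nat} 2 = {{0, 1}}"
    by (simp add: lessThan_2 nsets_2_eq insert_Diff_if insert_commute)
  then have "edges (book n) = insert {Inl 0, Inl 1} {{Inl u, Inr v} | u v. u \<in> {..<2} \<and> v \<in> {..<n}}"
    by (simp add: book_def graph_join_def complete_graph_def empty_graph_def)
  also have "{{Inl u, Inr v} | u v. u \<in> {..<2::nat} \<and> v \<in> {..<n}} =
      (\<lambda>v. {Inl 0, Inr v}) ` {..<n} \<union> (\<lambda>v. {Inl 1, Inr v}) ` {..<n}"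
    unfolding lessThan_2 by blast
  finally show ?thesis .
qed

text \<open>With \<open>Suc s\<close> colors available, using at most \<open>s\<close> means missing
  some color \<open>k\<close>, whether or not the coloring is surjective. The pages can then be any
  vertices joined to both ends of the spine in other colors.\<close>

lemma contains_book_iff:
  assumes f: "edge_coloring (Suc s) p f"
  shows "contains_with_colors (book n) s p f \<longleftrightarrow>
    (\<exists>x y k. x < p \<and> y < p \<and> x \<noteq> y \<and> k \<in> {1..Suc s} \<and> f {x, y} \<noteq> k \<and>
      n \<le> card {z. z < p \<and> z \<noteq> x \<and> z \<noteq> y \<and> f {x, z} \<noteq> k \<and> f {y, z} \<noteq> k})"
    (is "?L \<longleftrightarrow> ?R")
proof
  assume ?L
  then obtain H \<phi> where H: "subgraph H (complete_graph p)" and s: "card (f ` edges H) \<le> s"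
    and bij: "bij_betw \<phi> (verts (book n)) (verts H)" and eH: "edges H = (\<lambda>e. \<phi> ` e) ` edges (book n)"
    unfolding contains_with_colors_def graph_isomorphic_def by blast
  have vH: "verts H \<subseteq> {..<p}" using H by (simp add: subgraph_def complete_graph_def)
  have "finite (f ` edges H)" by (simp add: eH edges_book)
  then have "\<not> {1..Suc s} \<subseteq> f ` edges H"
    using s card_mono[of "f ` edges H" "{1..Suc s}"] by auto
  then obtain k where k: "k \<in> {1..Suc s}" "k \<notin> f ` edges H" by blast
  have inj: "inj_on \<phi> (verts (book n))" and img: "\<phi> ` verts (book n) = verts H"
    using bij by (auto simp: bij_betw_def)
  define x y Z where "x = \<phi> (Inl 0)" and "y = \<phi> (Inl 1)" and "Z = (\<lambda>v. \<phi> (Inr v)) ` {..<n}"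
  have xy: "x \<noteq> y" using inj by (auto simp: inj_on_def verts_book x_def y_def)
  have lt: "x < p" "y < p" "\<forall>z\<in>Z. z < p"
    using img vH by (auto simp: verts_book x_def y_def Z_def)
  have "inj_on (\<lambda>v. \<phi> (Inr v)) {..<n}" using inj by (auto simp: inj_on_def verts_book)
  then have cZ: "card Z = n" by (simp add: Z_def card_image)
  have nZ: "x \<notin> Z" "y \<notin> Z" using inj by (auto simp: inj_on_def verts_book x_def y_def Z_def)
  have eH': "edges H = insert {x, y} ((\<lambda>z. {x, z}) ` Z \<union> (\<lambda>z. {y, z}) ` Z)"
    by (simp add: eH edges_book image_Un image_image x_def y_def Z_def)
  have "Z \<subseteq> {z. z < p \<and> z \<noteq> x \<and> z \<noteq> y \<and> f {x, z} \<noteq> k \<and> f {y, z} \<noteq> k}"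
    using lt nZ k(2) by (auto simp: eH')
  then have "n \<le> card {z. z < p \<and> z \<noteq> x \<and> z \<noteq> y \<and> f {x, z} \<noteq> k \<and> f {y, z} \<noteq> k}"
    unfolding cZ[symmetric] by (rule card_mono[rotated]) simp
  moreover have "f {x, y} \<noteq> k" using k(2) by (auto simp: eH')
  ultimately show ?R using xy lt k(1) by blast
next
  assume ?R
  then obtain x y k where xy: "x < p" "y < p" "x \<noteq> y" and k: "k \<in> {1..Suc s}" "f {x, y} \<noteq> k"
    and n: "n \<le> card {z. z < p \<and> z \<noteq> x \<and> z \<noteq> y \<and> f {x, z} \<noteq> k \<and> f {y, z} \<noteq> k}"
    by blast
  obtain Z where Z: "Z \<subseteq> {z. z < p \<and> z \<noteq> x \<and> z \<noteq> y \<and> f {x, z} \<noteq> k \<and> f {y, z} \<noteq> k}" "card Z = n" "finite Z"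
    using obtain_subset_with_card_n[OF n] by blast
  obtain g where g: "bij_betw g {..<n} Z"
    using ex_bij_betw_nat_finite[OF Z(3)] Z(2) by (auto simp: atLeast0LessThan)
  define \<phi> where "\<phi> = case_sum (\<lambda>u::nat. if u = 0 then x else y) g"
  have imgZ: "g ` {..<n} = Z" and injg: "inj_on g {..<n}" using g by (auto simp: bij_betw_def)
  have inj: "inj_on \<phi> (verts (book n))"
    using xy(3) Z(1) injg imgZ by (auto simp: inj_on_def verts_book \<phi>_def)
  have img: "\<phi> ` verts (book n) = {x, y} \<union> Z"
    by (simp add: verts_book \<phi>_def image_Un image_image imgZ)
  define H where "H = Graph ({x, y} \<union> Z) (insert {x, y} ((\<lambda>z. {x, z}) ` Z \<union> (\<lambda>z. {y, z}) ` Z))"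
  have eH: "edges H = (\<lambda>e. \<phi> ` e) ` edges (book n)"
    by (simp add: H_def edges_book \<phi>_def image_Un image_image flip: imgZ)
  have iso: "graph_isomorphic (book n) H"
    unfolding graph_isomorphic_def using inj img eH by (auto simp: bij_betw_def H_def)
  have sub: "subgraph H (complete_graph p)"
    using xy Z by (auto simp: subgraph_def simple_graph_def H_def complete_graph_def)
  have "f ` edges H \<subseteq> {1..Suc s} - {k}"
  proof -
    have "edges H \<subseteq> edges (complete_graph p)" using sub by (simp add: subgraph_def)
    then have "f ` edges H \<subseteq> {1..Suc s}" using f unfolding edge_coloring_def by blast
    moreover have "k \<notin> f ` edges H" using k(2) Z(1) by (auto simp: H_def)
    ultimately show ?thesis by blast
  qed
  then have "card (f ` edges H) \<le> card ({1..Suc s} - {k})" by (rule card_mono[rotated]) simp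
  then have "card (f ` edges H) \<le> s" using k(1) by simp
  then show ?L unfolding contains_with_colors_def using sub iso by blast
qed

lemma book_upper:
  assumes f: "gallai_coloring 3 15 f"
  shows "contains_with_colors (book 9) 2 15 f"
proof (rule ccontr)
  assume no: "\<not> ?thesis"
  have ec: "edge_coloring (Suc 2) 15 f" using f by (simp add: gallai_coloring_def)
  interpret gallai3 "{..<15::nat}" "\<lambda>x y. f {x, y}" "{1..3::nat}"
  proof
    show "f {x, y} \<in> {1..3}" if "x \<in> {..<15}" "y \<in> {..<15}" "x \<noteq> y" for x y
      using ec that by (auto simp: edge_coloring_def complete_graph_def Pi_iff)
    show "f {x, y} = f {x, z} \<or> f {x, y} = f {y, z} \<or> f {x, z} = f {y, z}"
      if "x \<in> {..<15}" "y \<in> {..<15}" "z \<in> {..<15}" "x \<noteq> y" "x \<noteq> z" "y \<noteq> z" for x y z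
      using f that unfolding gallai_coloring_def rainbow_triangle_def
      by (auto simp: complete_graph_def)
  qed (auto simp: insert_commute)
  have "5 \<le> card (nb k x \<union> nb k y)"
    if xy: "x \<in> {..<15}" "y \<in> {..<15}" "x \<noteq> y" "k \<in> {1..3}" "f {x, y} \<noteq> k" for x y k
  proof -
    let ?Z = "{z. z < 15 \<and> z \<noteq> x \<and> z \<noteq> y \<and> f {x, z} \<noteq> k \<and> f {y, z} \<noteq> k}"
    \<comment> \<open>At most 8 of the 13 vertices off the edge avoid \<open>k\<close> at both ends,
      so at least 5 lie in a \<open>k\<close>-neighborhood.\<close>
    have "\<not> 9 \<le> card ?Z"
      using no xy unfolding contains_book_iff[OF ec] by auto
    moreover have "{..<15} - {x, y} \<subseteq> ?Z \<union> (nb k x \<union> nb k y)" by (auto simp: nb_def)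
    then have "card ({..<15} - {x, y}) \<le> card (?Z \<union> (nb k x \<union> nb k y))"
      by (intro card_mono) auto
    moreover have "card (?Z \<union> (nb k x \<union> nb k y)) \<le> card ?Z + card (nb k x \<union> nb k y)"
      by (rule card_Un_le)
    moreover have "card ({..<15} - {x, y}) = 13"
      using xy by (subst card_Diff_subset) auto
    ultimately show ?thesis by linarith
  qed
  then show False using no_coloring_15 by auto
qed

text \<open>Two copies of the 3-by-3 rook's graph with two cells of one row deleted (adjacent cells
  get color 2, the others color 3), joined by color 1.  The rook's graph is self-complementary and
  each of its edges lies in a single triangle.\<close>

definition rook_color :: "nat \<Rightarrow> nat \<Rightarrow> nat" where
  "rook_color x y = (if x div 7 \<noteq> y div 7 then 1
    else if x mod 7 div 3 = y mod 7 div 3 \<or> x mod 7 mod 3 = y mod 7 mod 3 then 2 else 3)"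

definition rook_coloring :: "nat set \<Rightarrow> nat" where
  "rook_coloring e = rook_color (Min e) (Max e)"

lemma rook_coloring_edge: "rook_coloring {x, y} = rook_color x y"
proof -
  have "rook_color y x = rook_color x y" by (auto simp: rook_color_def)
  then show ?thesis by (simp add: rook_coloring_def min_def max_def)
qed

text \<open>A triangle meeting several blocks of 7 has at least two edges of color 1, and one inside
  a block has only colors 2 and 3. Hence \<open>p\<close> can be arbitrary.\<close>

lemma gallai_rook_coloring: "gallai_coloring 3 p rook_coloring"
proof -
  have "rook_coloring e \<in> {1..3}" for e by (simp add: rook_coloring_def rook_color_def)
  then show ?thesis
    unfolding gallai_coloring_def edge_coloring_def rainbow_triangle_def rook_coloring_edge
    by (auto simp: rook_color_def)
qed

text \<open>A finite check, put in terms of lists so that it can be evaluated. Of the 12 vertices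
  off an edge at most 8 remain as pages, one too few.\<close>

lemma rook_color_spread:
  "\<forall>x\<in>set [0..<14]. \<forall>y\<in>set [0..<14]. \<forall>k\<in>set [1, 2, 3]. x \<noteq> y \<longrightarrow> rook_color x y \<noteq> k \<longrightarrow>
    4 \<le> length (filter (\<lambda>z. z \<noteq> x \<and> z \<noteq> y \<and> (rook_color x z = k \<or> rook_color y z = k)) [0..<14])"
  by code_simp

lemma book_lower:
  assumes "p \<le> 14"
  shows "\<not> contains_with_colors (book 9) 2 p rook_coloring"
proof
  assume contains: "contains_with_colors (book 9) 2 p rook_coloring"
  have ec: "edge_coloring (Suc 2) p rook_coloring"
    using gallai_rook_coloring by (simp add: gallai_coloring_def)
  obtain x y k where xy: "x < p" "y < p" "x \<noteq> y" "k \<in> {1..Suc 2}" "rook_color x y \<noteq> k"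
    and nine: "9 \<le> card {z. z < p \<and> z \<noteq> x \<and> z \<noteq> y \<and> rook_color x z \<noteq> k \<and> rook_color y z \<noteq> k}"
    using contains unfolding contains_book_iff[OF ec] rook_coloring_edge by blast
  let ?A = "{z. z < p \<and> z \<noteq> x \<and> z \<noteq> y \<and> rook_color x z \<noteq> k \<and> rook_color y z \<noteq> k}"
  let ?l = "filter (\<lambda>z. z \<noteq> x \<and> z \<noteq> y \<and> (rook_color x z = k \<or> rook_color y z = k)) [0..<14]"
  have "k \<in> set [1, 2, 3]" using xy(4) by auto
  then have "4 \<le> length ?l"
    using rook_color_spread[rule_format, of x y k] xy(1-3,5) assms by simp
  then have four: "4 \<le> card (set ?l)" by (simp only: distinct_card distinct_filter distinct_upt)
  \<comment> \<open>The list ranges over all 14 vertices even if \<open>p\<close> is smaller: 9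
    pages and 4 excluded vertices do not fit into the 12 vertices off the spine.\<close>
  have "card (?A \<union> set ?l) = card ?A + card (set ?l)"
    by (rule card_Un_disjoint) auto
  moreover have "card (?A \<union> set ?l) \<le> card ({..<14} - {x, y})"
    using assms by (intro card_mono) auto
  moreover have "card ({..<14} - {x, y}) = 12"
    using xy assms by (subst card_Diff_subset) auto
  ultimately show False using four nine by linarith
qed

theorem theorem4p5: "weakened_gallai_ramsey 3 2 (book 9) = 15"
  unfolding weakened_gallai_ramsey_def
proof (rule Least_equality)
  show "\<forall>f. gallai_coloring 3 15 f \<longrightarrow> contains_with_colors (book 9) 2 15 f"
    using book_upper by blast
next
  fix p assume "\<forall>f. gallai_coloring 3 p f \<longrightarrow> contains_with_colors (book 9) 2 p f"
  then have "\<not> p \<le> 14" using gallai_rook_coloring book_lower by blast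
  then show "15 \<le> p" by simp
qed

end
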